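(* Let $H:\mathbb{R}^{2n}\to\mathbb{R}$ be smooth and consider the $S^1$-equivariant Hamiltonian system $\mathbf{M}Z_t=\nabla H(Z)$ on $\mathbb{R}^{2n}$ described in the context, with momentum $I$ and infinitesimal generator $g(Z)$. Suppose a smooth family $\mathcal{U}(c)$ of relative equilibria, $\nabla H(\mathcal{U}(c))=c\,\nabla I(\mathcal{U}(c))$, exists for all $c$ in an open set $\mathscr{C}\subset\mathbb{R}$, with $\frac{dI}{dc}\neq0$ where $I(c)=I(\mathcal{U}(c))$, and suppose that $\mathbf{L}=D^2H(\mathcal{U}(c))-c\,D^2I(\mathcal{U}(c))$ has a simple zero eigenvalue for all $c\in\mathscr{C}$. Then, for each $c\in\mathscr{C}$, the characteristic function $$D(\lambda)=\tfrac12\|g(\mathcal{U}(c))\|^2\,\det[\mathbf{L}-\lambda\mathbf{M}]$$ satisfies $$D(0)=0,\qquad D'(0)=0,\qquad D''(0)=\mu(\mathbf{L})\,\frac{dI}{dc},$$ where $\mu(\mathbf{L})$ is the product of the nonzero eigenvalues of $\mathbf{L}$ (counted with multiplicity).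
   Context: $\mathbf{M}=\begin{pmatrix}\mathbf{0}&-\mathbf{I}_n\\ \mathbf{I}_n&\mathbf{0}\end{pmatrix}$. There is an orthogonal (linear) action $\theta\mapsto\mathrm{G}_\theta$ of $S^1$ on $\mathbb{R}^{2n}$ with $\mathrm{G}_\theta^T\mathbf{M}\mathrm{G}_\theta=\mathbf{M}$ and $H(\mathrm{G}_\theta Z)=H(Z)$ for all $\theta\in S^1$, $Z\in\mathbb{R}^{2n}$. Set $g(Z)=\frac{d}{d\theta}\mathrm{G}_\theta Z\big|_{\theta=0}=\mathbf{S}Z$ with $\mathbf{S}^T=-\mathbf{S}$; the momentum is $I(Z)=\tfrac12\langle\mathbf{M}\mathbf{S}Z,Z\rangle$, so that $\mathbf{M}g(Z)=\nabla I(Z)$. $\langle\cdot,\cdot\rangle$ and $\|\cdot\|$ are the Euclidean inner product and norm. Relative equilibria are the solutions $Z(t)=\mathrm{G}_{\theta(t)}\mathcal{U}(c)$ with $\theta(t)=ct+\theta^o$, which is equivalent to $\nabla H(\mathcal{U})=c\nabla I(\mathcal{U})$. Primes denote $d/d\lambda$. ($\mathbf{L}$ is a symmetric matrix, and $g(\mathcal{U}(c))$ is in its kernel.) *)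

theory Defs
  imports "HOL-Analysis.Analysis" "HOL-Computational_Algebra.Polynomial"
begin

(* \<real>^{2n} is modelled as real ^ ('n + 'n): Inl indexes the first n coordinates,
   Inr the last n. *)

definition sympl :: "real ^ ('n::finite + 'n) ^ ('n + 'n)" where
  "sympl = (\<chi> i j. case i of
      Inl a \<Rightarrow> (case j of Inl b \<Rightarrow> 0 | Inr b \<Rightarrow> if a = b then - 1 else 0)
    | Inr a \<Rightarrow> (case j of Inl b \<Rightarrow> if a = b then 1 else 0 | Inr b \<Rightarrow> 0))"

(* Class C^k on a set; meant for open S. *)
primrec ck_on :: "nat \<Rightarrow> 'a::real_normed_vector set \<Rightarrow> ('a \<Rightarrow> 'b::real_normed_vector) \<Rightarrow> bool" where
  "ck_on 0 S f \<longleftrightarrow> continuous_on S f"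
| "ck_on (Suc k) S f \<longleftrightarrow> (\<forall>x\<in>S. f differentiable (at x)) \<and>
     (\<forall>v. ck_on k S (\<lambda>x. frechet_derivative f (at x) v))"

definition smooth_on :: "'a::real_normed_vector set \<Rightarrow> ('a \<Rightarrow> 'b::real_normed_vector) \<Rightarrow> bool" where
  "smooth_on S f \<longleftrightarrow> (\<forall>k. ck_on k S f)"

definition gradient :: "(real ^ 'm \<Rightarrow> real) \<Rightarrow> real ^ 'm \<Rightarrow> real ^ 'm::finite" where
  "gradient f x = (\<chi> i. frechet_derivative f (at x) (axis i 1))"

definition hessian :: "(real ^ 'm \<Rightarrow> real) \<Rightarrow> real ^ 'm \<Rightarrow> real ^ 'm ^ 'm::finite" where
  "hessian f x = jacobian (gradient f) (at x)"

(* An orthogonal linear action of S^1 = \<real> / 2\<pi>\<int>, as a 2\<pi>-periodic one-parameter group of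
   orthogonal matrices. Continuity already makes such a group smooth in its parameter. *)
definition orthogonal_circle_action :: "(real \<Rightarrow> real ^ 'm ^ 'm::finite) \<Rightarrow> bool" where
  "orthogonal_circle_action G \<longleftrightarrow>
     continuous_on UNIV G \<and> G 0 = mat 1 \<and> (\<forall>s t. G (s + t) = G s ** G t) \<and>
     (\<forall>t. G (t + 2 * pi) = G t) \<and> (\<forall>t. orthogonal_matrix (G t))"

definition infgen :: "(real \<Rightarrow> real ^ 'm ^ 'm) \<Rightarrow> real ^ 'm \<Rightarrow> real ^ 'm::finite" where
  "infgen G Z = vector_derivative (\<lambda>\<theta>. G \<theta> *v Z) (at 0)"

definition infgen_matrix :: "(real \<Rightarrow> real ^ 'm ^ 'm) \<Rightarrow> real ^ 'm ^ 'm::finite" where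
  "infgen_matrix G = matrix (infgen G)"

definition momentum ::
  "(real \<Rightarrow> real ^ ('n::finite + 'n) ^ ('n + 'n)) \<Rightarrow> real ^ ('n + 'n) \<Rightarrow> real" where
  "momentum G Z = 1/2 * (((sympl ** infgen_matrix G) *v Z) \<bullet> Z)"

definition charpoly :: "real ^ 'm ^ 'm::finite \<Rightarrow> real poly" where
  "charpoly A = det (\<chi> i j. (if i = j then [:0, 1:] else 0) - [:A $ i $ j:])"

(* Real eigenvalues; these are all the eigenvalues when A is symmetric. *)
definition eigenvalues :: "real ^ 'm ^ 'm::finite \<Rightarrow> real set" where
  "eigenvalues A = {x. \<exists>v. v \<noteq> 0 \<and> A *v v = x *\<^sub>R v}"

definition simple_eigenvalue :: "real ^ 'm ^ 'm::finite \<Rightarrow> real \<Rightarrow> bool" where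
  "simple_eigenvalue A x \<longleftrightarrow> x \<in> eigenvalues A \<and> order x (charpoly A) = 1"

definition nonzero_eigenvalue_prod :: "real ^ 'm ^ 'm::finite \<Rightarrow> real" where
  "nonzero_eigenvalue_prod A = (\<Prod>x\<in>eigenvalues A - {0}. x ^ order x (charpoly A))"

definition lin_op ::
  "(real ^ ('n::finite + 'n) \<Rightarrow> real) \<Rightarrow> (real \<Rightarrow> real ^ ('n + 'n) ^ ('n + 'n)) \<Rightarrow>
   (real \<Rightarrow> real ^ ('n + 'n)) \<Rightarrow> real \<Rightarrow> real ^ ('n + 'n) ^ ('n + 'n)" where
  "lin_op H G U c = hessian H (U c) - c *\<^sub>R hessian (momentum G) (U c)"

definition char_fun ::
  "(real ^ ('n::finite + 'n) \<Rightarrow> real) \<Rightarrow> (real \<Rightarrow> real ^ ('n + 'n) ^ ('n + 'n)) \<Rightarrow>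
   (real \<Rightarrow> real ^ ('n + 'n)) \<Rightarrow> real \<Rightarrow> real \<Rightarrow> real" where
  "char_fun H G U c z =
     1/2 * (norm (infgen G (U c)))\<^sup>2 * det (lin_op H G U c - z *\<^sub>R sympl)"

end

(* Differentiating the relative equilibrium equation along the orbit and along the family gives
   L v = 0 for v = g(U(c)) and L U'(c) = M v, that is, a Jordan chain: (L - z M) (v + z U'(c)) is
   - z^2 M U'(c).  In an orthonormal eigenbasis of L, v is a multiple of a single basis vector e_k,
   so Cramer's rule applied to v + z U'(c) in the k-th column shows that det (L - z M) vanishes to
   second order and that its z^2 coefficient is the product of the nonzero eigenvalues times
   <M v, U'(c)> / |v|^2; finally <M v, U'(c)> = dI/dc. *)
theory Submission
  imports Defs
begin

text \<open>Regularity is one obstacle. \<open>infgen\<close> is a \<open>vector_derivative\<close>,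
  which is informative only where the derivative exists, so the continuous group \<open>G\<close>
  must first be shown differentiable at 0; and an orthonormal eigenbasis of L requires a symmetric
  Hessian, hence equality of mixed second derivatives. Cramer's rule replaces any perturbation of
  eigenvalues: det (L - z M) is multiplied by a factor affine in z, the k-th coordinate of v + z
  U'(c), and everything is read off from the coefficients of one polynomial identity. Simplicity of
  the zero eigenvalue is what singles out k. The prefactor of \<open>char_fun\<close> is the one
  that normalizes the result: 1/2 cancels the 2 from differentiating z^2 twice, and |v|^2 cancels
  the denominator of the coefficient. That v is nonzero follows from dI/dc being nonzero.\<close>

section \<open>Real symmetric matrices and determinants of pencils\<close>

text \<open>A maximiser of the Rayleigh quotient on the unit sphere of \<open>S\<close> is an eigenvector.\<close>

lemma symmetric_eigenvector_in_subspace: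
  fixes f :: "'a::euclidean_space \<Rightarrow> 'a"
  assumes lin: "linear f" and sym: "\<And>x y. f x \<bullet> y = x \<bullet> f y"
    and S: "subspace S" "f ` S \<subseteq> S" "S \<noteq> {0}"
  obtains x m where "x \<in> S" "norm x = 1" "f x = m *\<^sub>R x"
proof -
  interpret f: linear f by fact
  let ?K = "sphere 0 1 \<inter> S"
  have "0 \<in> S" using S(1) by (rule subspace_0)
  then obtain y where y: "y \<in> S" "y \<noteq> 0" using S(3) by blast
  then have "y /\<^sub>R norm y \<in> ?K" using S(1) by (auto intro: subspace_scale)
  moreover have "compact ?K" using S(1) by (intro compact_Int_closed closed_subspace) auto
  moreover have "continuous_on ?K (\<lambda>x. x \<bullet> f x)"
    using lin by (intro continuous_intros linear_continuous_on linear_linear[THEN iffD1]) (simp_all add: linear_linear)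
  ultimately obtain x where x: "x \<in> ?K" and max: "\<And>z. z \<in> ?K \<Longrightarrow> z \<bullet> f z \<le> x \<bullet> f x"
    using continuous_attains_sup[of ?K "\<lambda>x. x \<bullet> f x"] by blast
  define m where "m = x \<bullet> f x"
  define g where "g z = m * (z \<bullet> z) - z \<bullet> f z" for z
  have g_nonneg: "0 \<le> g z" if "z \<in> S" for z
  proof (cases "z = 0")
    case False
    let ?w = "z /\<^sub>R norm z"
    have "?w \<in> ?K" using False that S(1) by (auto intro: subspace_scale)
    from max[OF this] have "z \<bullet> f z / (norm z * norm z) \<le> m"
      by (simp add: m_def f.scaleR divide_inverse mult_ac)
    then have "z \<bullet> f z \<le> m * (norm z * norm z)" using False by (simp add: divide_le_eq)
    then show ?thesis by (simp add: g_def dot_square_norm power2_eq_square)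
  qed (simp add: g_def f.zero)
  \<comment> \<open>z is the residual of the eigenvalue equation and half the gradient of
    \<open>g\<close> at x. Since \<open>g\<close> is nonnegative on S and vanishes at x, moving from
    x against z inside S would make it negative unless z = 0.\<close>
  define z where "z = m *\<^sub>R x - f x"
  have zS: "z \<in> S" using x S unfolding z_def by (intro subspace_diff subspace_scale) auto
  have xx: "x \<bullet> x = 1" using x by (simp add: norm_eq_1)
  have expand: "g (x + t *\<^sub>R z) = 2 * t * (z \<bullet> z) + t\<^sup>2 * g z" for t
  proof -
    have zz: "z \<bullet> z = m * (x \<bullet> z) - f x \<bullet> z" by (simp add: z_def inner_diff_left)
    have "g (x + t *\<^sub>R z) = (m * (x \<bullet> x) - x \<bullet> f x) + 2 * t * (m * (x \<bullet> z) - f x \<bullet> z) + t\<^sup>2 * g z"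
      using sym[of x z]
      by (simp add: g_def f.add f.scaleR inner_add_left inner_add_right inner_commute[of z x]
          inner_commute[of z "f x"] algebra_simps power2_eq_square)
    then show ?thesis by (simp add: zz xx m_def)
  qed
  have "z \<bullet> z = 0"
  proof (rule ccontr)
    assume "z \<bullet> z \<noteq> 0"
    then have a: "z \<bullet> z > 0" by simp
    let ?a = "z \<bullet> z"
    \<comment> \<open>The added 1 keeps b positive even if \<open>g z = 0\<close>. The t below
      minimizes 2 t a + t^2 b, with value -a^2/b.\<close>
    define b where "b = g z + 1"
    have b: "b > 0" using g_nonneg[OF zS] by (simp add: b_def)
    define t where "t = - ?a / b"
    have "x + t *\<^sub>R z \<in> S" using x zS S(1) by (auto intro: subspace_add subspace_scale)
    from g_nonneg[OF this] have "0 \<le> 2 * t * ?a + t\<^sup>2 * g z" by (simp add: expand)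
    also have "\<dots> \<le> 2 * t * ?a + t\<^sup>2 * b" by (simp add: mult_left_mono b_def)
    also have "\<dots> = - (?a\<^sup>2 / b)" using b by (simp add: t_def field_simps power2_eq_square)
    also have "\<dots> < 0" using a b by simp
    finally show False by simp
  qed
  then have "f x = m *\<^sub>R x" by (simp add: z_def)
  then show thesis using x by (intro that[of x m]) auto
qed

text \<open>Induction on the dimension: split off a unit eigenvector x and continue in its
  orthogonal complement inside S, which f preserves because x . f y = f x . y = m (x . y). Invariant
  subspaces appear in the statement so that the induction can pass to this complement.\<close>

lemma symmetric_orthonormal_eigenbasis_subspace:
  fixes f :: "'a::euclidean_space \<Rightarrow> 'a"
  assumes "linear f" "\<And>x y. f x \<bullet> y = x \<bullet> f y" "subspace S" "f ` S \<subseteq> S"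
  shows "\<exists>B\<subseteq>S. pairwise orthogonal B \<and> (\<forall>b\<in>B. norm b = 1 \<and> (\<exists>m. f b = m *\<^sub>R b)) \<and> span B = S"
  using assms(3,4)
proof (induction "dim S" arbitrary: S rule: less_induct)
  case less
  show ?case
  proof (cases "S = {0}")
    case True
    then show ?thesis by (intro exI[of _ "{}"]) auto
  next
    case False
    obtain x m where x: "x \<in> S" "norm x = 1" "f x = m *\<^sub>R x"
      using symmetric_eigenvector_in_subspace[OF assms(1,2) less.prems False] by blast
    have xx: "x \<bullet> x = 1" using x by (simp add: norm_eq_1)
    let ?T = "S \<inter> {y. x \<bullet> y = 0}"
    have T: "subspace ?T" using less.prems by (intro subspace_inter subspace_hyperplane) auto
    have "x \<notin> ?T" using xx by auto
    then have "?T \<subset> S" using x by blast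
    then have "span ?T \<subset> span S"
      using T less.prems span_eq_iff by metis
    then have dimT: "dim ?T < dim S" by (rule dim_psubset)
    have "f ` ?T \<subseteq> ?T"
      using less.prems x assms(2)[of x] by (auto simp flip: assms(2))
    with less.hyps[OF dimT T] obtain B where B: "B \<subseteq> ?T" "pairwise orthogonal B"
      "\<forall>b\<in>B. norm b = 1 \<and> (\<exists>m. f b = m *\<^sub>R b)" "span B = ?T" by blast
    have "span (insert x B) = S"
    proof
      show "span (insert x B) \<subseteq> S" using B x less.prems by (intro span_minimal) auto
      show "S \<subseteq> span (insert x B)"
      proof
        fix y assume "y \<in> S"
        then have "y - (x \<bullet> y) *\<^sub>R x \<in> span B"
          using x less.prems by (simp add: B subspace_diff subspace_scale inner_diff_right xx)
        then show "y \<in> span (insert x B)" using span_breakdown_eq by blast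
      qed
    qed
    moreover have "pairwise orthogonal (insert x B)"
      using B by (auto simp: pairwise_insert orthogonal_def inner_commute)
    ultimately show ?thesis
      using B x by (intro exI[of _ "insert x B"]) auto
  qed
qed

abbreviation diagonal :: "('n \<Rightarrow> 'a::zero) \<Rightarrow> 'a ^ 'n ^ 'n::finite" where
  "diagonal d \<equiv> \<chi> i j. if i = j then d i else 0"

lemma diagonal_mult_vector_nth:
  fixes x :: "'a::semiring_1 ^ 'n"
  shows "(diagonal d *v x) $ i = d i * x $ i"
  by (simp add: matrix_vector_mult_def if_distrib[of "\<lambda>a. a * _"] cong: if_cong)

theorem real_symmetric_diagonalizable:
  fixes A :: "real ^ 'n ^ 'n"
  assumes "transpose A = A"
  obtains Q d where "orthogonal_matrix Q" "transpose Q ** A ** Q = diagonal d"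
proof -
  have "\<And>x y. (A *v x) \<bullet> y = x \<bullet> (A *v y)"
    using assms by (metis dot_lmul_matrix transpose_matrix_vector)
  then obtain B where B: "pairwise orthogonal B" "\<forall>b\<in>B. norm b = 1 \<and> (\<exists>m. A *v b = m *\<^sub>R b)"
    "span B = UNIV"
    using symmetric_orthonormal_eigenbasis_subspace[of "(*v) A" UNIV] by auto
  have "0 \<notin> B" using B(2) by force
  then have ind: "independent B" using B(1) by (rule pairwise_orthogonal_independent[rotated])
  then have "card B = CARD('n)" using B(3) by (metis dim_UNIV dim_span_eq_card_independent DIM_cart DIM_real mult_1_right)
  moreover have "finite B" using ind by (rule finiteI_independent)
  \<comment> \<open>The basis has \<open>CARD('n)\<close> elements, so the index type itself can
    enumerate it; \<open>f j\<close> becomes column j of \<open>Q\<close>.\<close>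
  ultimately obtain f where f: "bij_betw f (UNIV :: 'n set) B"
    by (metis finite_class.finite_UNIV finite_same_card_bij)
  then have fB: "f i \<in> B" for i by (auto simp: bij_betw_def)
  have ort: "f i \<bullet> f j = (if i = j then 1 else 0)" for i j
  proof (cases "i = j")
    case True
    then show ?thesis using B(2) fB[of j] by (simp add: norm_eq_1)
  next
    case False
    then have "f i \<noteq> f j" using f by (auto simp: bij_betw_def inj_on_def)
    then show ?thesis using B(1) fB[of i] fB[of j] False by (auto simp: pairwise_def orthogonal_def)
  qed
  have "\<forall>i. \<exists>m. A *v f i = m *\<^sub>R f i" using B(2) fB by blast
  from choice[OF this] obtain d where d: "\<And>i. A *v f i = d i *\<^sub>R f i" by blast
  define Q where "Q = (\<chi> i j. f j $ i)"
  have col: "column j Q = f j" for j by (simp add: Q_def column_def vec_eq_iff)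
  have "orthogonal_matrix Q"
    by (simp add: orthogonal_matrix_orthonormal_columns col norm_eq_1 orthogonal_def ort)
  moreover have "(transpose Q ** (A ** Q)) $ i $ j = diagonal d $ i $ j" for i j
  proof -
    have "(transpose Q ** (A ** Q)) $ i $ j = f i \<bullet> (A *v f j)"
      by (simp add: matrix_matrix_mult_def transpose_def Q_def inner_vec_def matrix_vector_mult_def)
    also have "\<dots> = diagonal d $ i $ j" by (simp add: d ort)
    finally show ?thesis .
  qed
  ultimately show thesis
    by (intro that[of Q d]) (auto simp: vec_eq_iff simp flip: matrix_mul_assoc)
qed

section \<open>Characteristic polynomials and eigenvalue multiplicities\<close>

lemma poly_det:
  fixes A :: "'a::comm_ring_1 poly ^ 'n ^ 'n"
  shows "poly (det A) x = det (\<chi> i j. poly (A $ i $ j) x)"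
  by (simp add: det_def poly_sum poly_prod)

lemma poly_charpoly: "poly (charpoly A) x = det (mat x - A)"
  unfolding charpoly_def poly_det
  by (rule arg_cong[where f = det]) (simp add: vec_eq_iff mat_def)

lemma eigenvalues_iff_poly_charpoly: "x \<in> eigenvalues A \<longleftrightarrow> poly (charpoly A) x = 0"
proof -
  have "x \<in> eigenvalues A \<longleftrightarrow> (\<exists>v. v \<noteq> 0 \<and> (mat x - A) *v v = 0)"
  proof -
    have "mat x *v v = x *\<^sub>R v" for v :: "real ^ 'a"
      by (simp add: vec_eq_iff matrix_vector_mult_def mat_def if_distrib[of "\<lambda>a. a * _"] cong: if_cong)
    then show ?thesis by (auto simp: eigenvalues_def matrix_vector_mult_diff_rdistrib)
  qed
  also have "\<dots> \<longleftrightarrow> det (mat x - A) = 0"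
    by (metis invertible_det_nz invertible_left_inverse matrix_left_invertible_ker)
  finally show ?thesis by (simp add: poly_charpoly)
qed

lemma det_orthogonal_conjugate:
  fixes Q :: "real ^ 'n ^ 'n"
  assumes "orthogonal_matrix Q"
  shows "det (transpose Q ** A ** Q) = det A"
proof -
  have "det (transpose Q) * det Q = 1"
    using assms by (metis det_I det_mul orthogonal_matrix)
  then show ?thesis by (simp add: det_mul mult.commute)
qed

lemma matrix_mult_diff_distribs:
  fixes A B C :: "'a::ring_1 ^ 'n ^ 'n"
  shows "A ** (B - C) = A ** B - A ** C" "(B - C) ** A = B ** A - C ** A"
  by (simp_all add: vec_eq_iff matrix_matrix_mult_def left_diff_distrib right_diff_distrib sum_subtractf)

lemma charpoly_orthogonally_diagonalized:
  assumes Q: "orthogonal_matrix Q" "transpose Q ** A ** Q = diagonal d"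
  shows "charpoly A = (\<Prod>i\<in>UNIV. [:- d i, 1:])"
proof (rule poly_eq_poly_eq_iff[THEN iffD1], rule ext)
  fix x
  have "transpose Q ** mat x ** Q = mat x"
  proof -
    have "mat x = x *\<^sub>R (mat 1 :: real ^ 'a ^ 'a)" by (simp add: vec_eq_iff mat_def)
    then show ?thesis using Q(1)
      by (simp add: orthogonal_matrix matrix_scalar_ac scalar_matrix_assoc[symmetric] flip: scalar_mult_eq_scaleR)
  qed
  then have "transpose Q ** (mat x - A) ** Q = diagonal (\<lambda>i. x - d i)"
    using Q(2) by (simp add: matrix_mult_diff_distribs) (simp add: vec_eq_iff mat_def)
  then have "det (mat x - A) = (\<Prod>i\<in>UNIV. x - d i)"
    using det_orthogonal_conjugate[OF Q(1), of "mat x - A"] by (simp add: det_diagonal)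
  then show "poly (charpoly A) x = poly (\<Prod>i\<in>UNIV. [:- d i, 1:]) x"
    by (simp add: poly_charpoly poly_prod)
qed

lemma order_prod_linear:
  fixes d :: "'i \<Rightarrow> 'a::idom"
  assumes "finite I"
  shows "order x (\<Prod>i\<in>I. [:- d i, 1:]) = card {i\<in>I. d i = x}"
  using assms
proof induction
  case (insert a I)
  have nz: "(\<Prod>i\<in>J. [:- d i, 1:]) \<noteq> 0" if "finite J" for J
    using that by simp
  have "order x [:- d a, 1:] = (if d a = x then 1 else 0)"
    using order_power_n_n[of x 1] by (auto simp: order_root intro: order_0I)
  moreover have "{i \<in> insert a I. d i = x} = (if d a = x then insert a {i\<in>I. d i = x} else {i\<in>I. d i = x})"
    by auto
  ultimately show ?case
    using insert nz[of "insert a I"] by (simp add: order_mult del: mult_pCons_left)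
qed simp

text \<open>Indices are grouped into the fibres of \<open>d\<close>: the fibre over x has as many
  elements as the multiplicity of x as a root of \<open>charpoly A\<close>.\<close>

lemma nonzero_eigenvalue_prod_orthogonally_diagonalized:
  assumes Q: "orthogonal_matrix Q" "transpose Q ** A ** Q = diagonal d"
  shows "nonzero_eigenvalue_prod A = (\<Prod>i | d i \<noteq> 0. d i)"
proof -
  have ev: "eigenvalues A - {0} = d ` {i. d i \<noteq> 0}"
    using eigenvalues_iff_poly_charpoly[of _ A]
    by (auto simp: charpoly_orthogonally_diagonalized[OF Q] poly_prod)
  have "(\<Prod>i | d i \<noteq> 0. d i) = (\<Prod>x\<in>d ` {i. d i \<noteq> 0}. \<Prod>i | i \<in> {i. d i \<noteq> 0} \<and> d i = x. d i)"
    by (rule prod.image_gen) simp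
  also have "\<dots> = (\<Prod>x\<in>d ` {i. d i \<noteq> 0}. x ^ card {i. d i = x})"
  proof (rule prod.cong)
    fix x assume "x \<in> d ` {i. d i \<noteq> 0}"
    then have "{i \<in> {i. d i \<noteq> 0}. d i = x} = {i. d i = x}" by auto
    then show "(\<Prod>i | i \<in> {i. d i \<noteq> 0} \<and> d i = x. d i) = x ^ card {i. d i = x}" by simp
  qed simp
  finally show ?thesis
    by (simp add: nonzero_eigenvalue_prod_def ev charpoly_orthogonally_diagonalized[OF Q] order_prod_linear)
qed

text \<open>A polynomial p is produced so that derivatives at 0 become coefficients. Powers of
  \<open>v \<bullet> v\<close> stand on the left instead of being divided out; the caller cancels
  them once v is known to be nonzero.\<close>

lemma second_order_det_pencil:
  fixes L M :: "real ^ 'n ^ 'n"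
  assumes L: "transpose L = L" "simple_eigenvalue L 0"
    and v: "L *v v = 0" and b: "L *v b = M *v v"
  obtains p where "\<And>z. poly p z = det (L - z *\<^sub>R M)" "coeff p 0 = 0"
    "(v \<bullet> v) * coeff p (Suc 0) = 0"
    "(v \<bullet> v)\<^sup>2 * coeff p 2 = - (v \<bullet> v) * (v \<bullet> (M *v b)) * nonzero_eigenvalue_prod L"
proof -
  obtain Q d where Q: "orthogonal_matrix Q" "transpose Q ** L ** Q = diagonal d"
    using real_symmetric_diagonalizable[OF L(1)] by blast
  define R where "R = transpose Q"
  have RQ: "R ** Q = mat 1" "Q ** R = mat 1"
    using Q(1) by (auto simp: orthogonal_matrix_def R_def)
  have QR: "Q *v (R *v x) = x" for x
    by (simp add: matrix_vector_mul_assoc RQ)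
  have tr: "(R *v x) \<bullet> y = x \<bullet> (Q *v y)" for x y
    by (simp add: R_def dot_lmul_matrix)
  have "order 0 (charpoly L) = 1" using L(2) by (simp add: simple_eigenvalue_def)
  then have "card {i. d i = 0} = 1"
    by (simp add: charpoly_orthogonally_diagonalized[OF Q] order_prod_linear)
  then obtain k where k: "{i. d i = 0} = {k}" by (auto simp: card_1_singleton_iff)
  then have dk: "d i = 0 \<longleftrightarrow> i = k" for i by auto
  define N where "N = R ** M ** Q"
  define w where "w = R *v v"
  define c where "c = R *v b"
  define D :: "real ^ 'n ^ 'n" where "D = diagonal d"
  have D: "D = R ** L ** Q" by (simp add: D_def Q(2) R_def)
  have Dw: "D *v w = 0"
    by (simp add: D w_def v QR flip: matrix_vector_mul_assoc)
  have Dc: "D *v c = N *v w"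
    by (simp add: D N_def w_def c_def b QR flip: matrix_vector_mul_assoc)
  have Dnth: "(D *v x) $ i = d i * x $ i" for x i
    by (simp add: D_def diagonal_mult_vector_nth)
  have wi: "w $ i = 0" if "i \<noteq> k" for i
    using Dnth[of w i] Dw dk that by simp
  define a where "a = w $ k"
  have inner_w: "w \<bullet> x = a * x $ k" for x
  proof -
    have "w \<bullet> x = (\<Sum>i\<in>UNIV. if i = k then a * x $ k else 0)"
      unfolding inner_vec_def by (rule sum.cong) (auto simp: wi a_def)
    then show ?thesis by simp
  qed
  have vv: "v \<bullet> v = a\<^sup>2"
    using tr[of v w] inner_w[of w] by (simp add: w_def QR) (simp add: w_def[symmetric] a_def power2_eq_square)
  have vMb: "v \<bullet> (M *v b) = a * (N *v c) $ k"
  proof -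
    have "N *v c = R *v (M *v b)" by (simp add: N_def c_def QR flip: matrix_vector_mul_assoc)
    then show ?thesis using tr[of v "N *v c"] inner_w[of "N *v c"] by (simp add: w_def QR)
  qed
  define p where "p = det (\<chi> i j. [:D $ i $ j, - N $ i $ j:])"
  have p_eq: "poly p z = det (D - z *\<^sub>R N)" for z
    by (simp add: p_def poly_det) (rule arg_cong[where f = det], simp add: vec_eq_iff)
  have "D - z *\<^sub>R N = R ** (L - z *\<^sub>R M) ** Q" for z
    by (simp add: matrix_mult_diff_distribs D N_def matrix_scalar_ac scalar_matrix_assoc)
  then have p: "poly p z = det (L - z *\<^sub>R M)" for z
    by (simp add: p_eq det_orthogonal_conjugate[OF Q(1)] R_def)
  define e where "e = N *v c"
  \<comment> \<open>The numerator in Cramer's rule for the k-th coordinate, with the factor -z^2 of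
    the right-hand side already taken out.\<close>
  define q where "q = det (\<chi> i j. if j = k then [:e $ i:] else [:D $ i $ j, - N $ i $ j:])"
  have q_eq: "poly q z = det (\<chi> i j. if j = k then e $ i else (D - z *\<^sub>R N) $ i $ j)" for z
    by (simp add: q_def poly_det) (rule arg_cong[where f = det], simp add: vec_eq_iff)
  have q0: "poly q 0 = e $ k * nonzero_eigenvalue_prod L"
  proof -
    \<comment> \<open>The k-th column is overwritten by e, so the zero diagonal entry there may be
      set to 1 without changing the matrix. This makes E invertible, and Cramer's rule for
      \<open>E *v y = e\<close> evaluates the determinant.\<close>
    define d1 where "d1 i = (if i = k then 1 else d i)" for i
    define E :: "real ^ 'n ^ 'n" where "E = diagonal d1"
    define y where "y = (\<chi> i. e $ i / d1 i)"
    have d1: "d1 i \<noteq> 0" for i by (simp add: d1_def dk)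
    have "E *v y = e"
      using d1 by (simp add: vec_eq_iff y_def E_def diagonal_mult_vector_nth)
    then have "(\<chi> i j. if j = k then e $ i else (D - 0 *\<^sub>R N) $ i $ j) = (\<chi> i j. if j = k then (E *v y) $ i else E $ i $ j)"
      by (simp add: vec_eq_iff D_def E_def d1_def)
    then have "poly q 0 = y $ k * det E" by (simp add: q_eq cramer_lemma)
    also have "det E = (\<Prod>i\<in>UNIV. d1 i)" by (simp add: E_def det_diagonal)
    also have "\<dots> = (\<Prod>i | d i \<noteq> 0. d i)"
      by (rule prod.mono_neutral_cong_right) (auto simp: d1_def dk)
    finally show ?thesis
      by (simp add: nonzero_eigenvalue_prod_orthogonally_diagonalized[OF Q] y_def d1_def)
  qed
  \<comment> \<open>For z \<noteq> 0 this is Cramer's rule applied to w + z c, rescaled by -1/z^2;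
    at z = 0 both sides vanish because det D = 0.\<close>
  have "[:a, c $ k:] * p = [:0, 0, -1:] * q"
  proof (rule poly_eq_poly_eq_iff[THEN iffD1], rule ext)
    fix z
    show "poly ([:a, c $ k:] * p) z = poly ([:0, 0, -1:] * q) z"
    proof (cases "z = 0")
      case True
      have "det D = 0" by (simp add: D_def det_diagonal dk)
      then show ?thesis by (simp add: True p_eq)
    next
      case False
      let ?x = "w + z *\<^sub>R c"
      have *: "(D - z *\<^sub>R N) *v ?x = - (z\<^sup>2 *\<^sub>R e)"
        by (simp add: matrix_vector_mult_diff_rdistrib matrix_vector_right_distrib Dw Dc e_def
            scaleR_matrix_vector_assoc[symmetric] matrix_vector_mult_scaleR algebra_simps power2_eq_square)
      define y where "y = (- 1 / z\<^sup>2) *\<^sub>R ?x"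
      have "(D - z *\<^sub>R N) *v y = e"
        using False * by (simp only: y_def matrix_vector_mult_scaleR) simp
      moreover have "y $ k = (- 1 / z\<^sup>2) * (a + z * c $ k)" by (simp add: y_def a_def)
      ultimately have "poly q z = (- 1 / z\<^sup>2) * (a + z * c $ k) * poly p z"
        using cramer_lemma[of k "D - z *\<^sub>R N" y] by (simp only: q_eq p_eq)
      then show ?thesis using False by (simp add: field_simps power2_eq_square)
    qed
  qed
  then have coeffs: "coeff ([:a, c $ k:] * p) i = coeff ([:0, 0, -1:] * q) i" for i by simp
  have p0: "coeff p 0 = 0"
    using p_eq[of 0] by (simp add: poly_0_coeff_0 D_def det_diagonal dk)
  have p1: "a * coeff p (Suc 0) = 0"
    using coeffs[of "Suc 0"] by (simp add: p0 mult_pCons_left coeff_pCons)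
  have p2: "a * coeff p 2 + c $ k * coeff p (Suc 0) = - coeff q 0"
    using coeffs[of 2] by (simp add: mult_pCons_left coeff_pCons numeral_2_eq_2)
  show thesis
  proof (rule that[OF p p0])
    show "(v \<bullet> v) * coeff p (Suc 0) = 0" using p1 by (simp add: vv power2_eq_square)
    \<comment> \<open>The factor a^3 removes the term with \<open>coeff p (Suc 0)\<close>, since a
      times that coefficient is 0, and turns the identity into one in a^2 =
      \<open>v \<bullet> v\<close> and a e_k = \<open>v \<bullet> (M *v b)\<close>.\<close>
    have "a ^ 4 * coeff p 2 = - (a ^ 3) * coeff q 0"
      using arg_cong[OF p2, of "\<lambda>r. a ^ 3 * r"] p1 by (simp add: algebra_simps power3_eq_cube power4_eq_xxxx)
    then show "(v \<bullet> v)\<^sup>2 * coeff p 2 = - (v \<bullet> v) * (v \<bullet> (M *v b)) * nonzero_eigenvalue_prod L"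
      using q0 by (simp add: vv vMb e_def poly_0_coeff_0 algebra_simps power2_eq_square power3_eq_cube power4_eq_xxxx)
  qed
qed

section \<open>Matrix groups and second derivatives\<close>

lemma bounded_bilinear_matrix_vector_mult:
  "bounded_bilinear ((*v) :: real ^ 'n ^ 'm \<Rightarrow> real ^ 'n \<Rightarrow> real ^ 'm)"
  unfolding bilinear_conv_bounded_bilinear[symmetric] bilinear_def
  by (auto intro!: linearI simp: matrix_vector_mult_add_rdistrib matrix_vector_right_distrib
      scaleR_matrix_vector_assoc matrix_vector_mult_scaleR)

lemma bounded_bilinear_matrix_matrix_mult:
  "bounded_bilinear ((**) :: real ^ 'n ^ 'm \<Rightarrow> real ^ 'k ^ 'n \<Rightarrow> real ^ 'k ^ 'm)"
  unfolding bilinear_conv_bounded_bilinear[symmetric] bilinear_def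
  by (auto intro!: linearI simp: matrix_add_ldistrib matrix_scalar_ac scalar_matrix_assoc)
     (simp add: vec_eq_iff matrix_matrix_mult_def distrib_right sum.distrib)

lemma bounded_linear_transpose: "bounded_linear (transpose :: real ^ 'n ^ 'm \<Rightarrow> real ^ 'm ^ 'n)"
  unfolding linear_conv_bounded_linear[symmetric]
  by (auto intro!: linearI simp: transpose_def vec_eq_iff)

lemma tendsto_det:
  fixes A :: "'a \<Rightarrow> real ^ 'n ^ 'n"
  assumes "(A \<longlongrightarrow> L) F"
  shows "((\<lambda>x. det (A x)) \<longlongrightarrow> det L) F"
  unfolding det_def by (intro tendsto_sum tendsto_mult tendsto_const tendsto_prod tendsto_vec_nth assms)

lemma has_vector_derivative_shift:
  assumes "(f has_vector_derivative D) (at (x + a))"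
  shows "((\<lambda>t. f (t + a)) has_vector_derivative D) (at x)"
proof -
  have "((\<lambda>t. t + a) has_vector_derivative 1) (at x)"
    using has_vector_derivative_add[OF has_vector_derivative_id has_vector_derivative_const] by simp
  from vector_diff_chain_at[OF this assms] show ?thesis by (simp add: o_def)
qed

text \<open>With \<open>F\<close> an antiderivative of \<open>G\<close>, the group law gives \<open>F (t + h) - F t = G t ** (F h - F 0)\<close>,
  and \<open>F h - F 0\<close> is invertible for small \<open>h\<close>; so \<open>G\<close> inherits the differentiability of \<open>F\<close>.\<close>

lemma continuous_matrix_group_differentiable:
  fixes G :: "real \<Rightarrow> real ^ 'n ^ 'n"
  assumes cont: "continuous_on UNIV G" and G0: "G 0 = mat 1"
    and add: "\<And>s t. G (s + t) = G s ** G t"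
  obtains S where "(G has_vector_derivative S) (at 0)"
proof -
  interpret mm: bounded_bilinear "(**) :: real ^ 'n ^ 'n \<Rightarrow> real ^ 'n ^ 'n \<Rightarrow> real ^ 'n ^ 'n"
    by (rule bounded_bilinear_matrix_matrix_mult)
  \<comment> \<open>The antiderivative is taken on [-1,1] only; bounding t and h by 1/2 below keeps
    t + h in the interior.\<close>
  obtain F where F: "\<And>x. x \<in> {-1..1} \<Longrightarrow> (F has_vector_derivative G x) (at x within {-1..1})"
    by (rule antiderivative_continuous[OF continuous_on_subset[OF cont subset_UNIV]]) (rule that)
  have F': "(F has_vector_derivative G x) (at x)" if "\<bar>x\<bar> < 1" for x
    using F[of x] at_within_Icc_at[of "-1" x 1] that unfolding abs_less_iff by simp
  have "((\<lambda>h. (F (0 + h) - F 0) /\<^sub>R h) \<longlongrightarrow> mat 1) (at 0)"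
  proof (rule tendsto_norm_zero_cancel[THEN LIM_zero_cancel])
    have "((\<lambda>h. norm (F (0 + h) - F 0 - h *\<^sub>R mat 1) / norm h) \<longlongrightarrow> 0) (at 0)"
      using F'[of 0] by (simp add: has_vector_derivative_def has_derivative_at G0)
    moreover have "\<forall>\<^sub>F h in at 0. norm (F (0 + h) - F 0 - h *\<^sub>R mat 1) / norm h
        = norm ((F (0 + h) - F 0) /\<^sub>R h - mat 1)"
    proof (rule eventually_at_filter[THEN iffD2], rule always_eventually, intro allI impI)
      fix h :: real assume "h \<noteq> 0"
      then have "(F (0 + h) - F 0) /\<^sub>R h - mat 1 = (F (0 + h) - F 0 - h *\<^sub>R mat 1) /\<^sub>R h"
        by (simp add: scaleR_diff_right)
      then show "norm (F (0 + h) - F 0 - h *\<^sub>R mat 1) / norm h = norm ((F (0 + h) - F 0) /\<^sub>R h - mat 1)"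
        by (simp add: divide_inverse_commute)
    qed
    ultimately show "((\<lambda>h. norm ((F (0 + h) - F 0) /\<^sub>R h - mat 1)) \<longlongrightarrow> 0) (at 0)"
      by (rule Lim_transform_eventually)
  qed
  \<comment> \<open>The difference quotients tend to the identity, whose determinant is 1, so they
    are invertible for small h > 0.\<close>
  then have "((\<lambda>h. det ((F h - F 0) /\<^sub>R h)) \<longlongrightarrow> det (mat 1 :: real ^ 'n ^ 'n)) (at_right 0)"
    using filterlim_at_split by (intro tendsto_det) fastforce
  then have "\<forall>\<^sub>F h in at_right 0. det ((F h - F 0) /\<^sub>R h) > 0"
    by (rule order_tendstoD) simp
  moreover have "\<forall>\<^sub>F h in at_right (0::real). h \<in> {0<..<1/2}"
    by (rule eventually_at_right_real) simp
  ultimately have "\<forall>\<^sub>F h in at_right 0. det ((F h - F 0) /\<^sub>R h) > 0 \<and> h \<in> {0<..<1/2}"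
    by eventually_elim simp
  from eventually_happens'[OF trivial_limit_at_right_real this]
  obtain h where h: "0 < h" "h < 1/2" and "det ((F h - F 0) /\<^sub>R h) > 0"
    unfolding greaterThanLessThan_iff by blast
  then have "invertible ((F h - F 0) /\<^sub>R h)" by (simp add: invertible_det_nz)
  then obtain B where "((F h - F 0) /\<^sub>R h) ** B = mat 1" by (auto simp: invertible_def)
  then have B: "(F h - F 0) ** (B /\<^sub>R h) = mat 1"
    by (simp add: mm.scaleR_left mm.scaleR_right)
  have shift: "F (t + h) - F t = G t ** (F h - F 0)" if t: "\<bar>t\<bar> < 1/2" for t
  proof -
    \<comment> \<open>By the group law this function has derivative
      \<open>G (t + s) - G t ** G s\<close> = 0; comparing s = h with s = 0 gives the claim.\<close>
    let ?\<phi> = "\<lambda>s. F (t + s) - G t ** F s"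
    have "(?\<phi> has_vector_derivative 0) (at s within {0..h})" if s: "s \<in> {0..h}" for s
    proof -
      have "((\<lambda>s. F (t + s)) has_vector_derivative G (t + s)) (at s)"
      proof -
        have "\<bar>s + t\<bar> < 1" using t s h by (auto simp: abs_less_iff)
        from has_vector_derivative_shift[OF F'[OF this]] show ?thesis by (simp add: add.commute)
      qed
      moreover have "((\<lambda>s. G t ** F s) has_vector_derivative G t ** G s) (at s)"
        using F'[of s] s h by (intro bounded_linear.has_vector_derivative[OF mm.bounded_linear_right]) auto
      ultimately have "(?\<phi> has_vector_derivative G (t + s) - G t ** G s) (at s)"
        by (rule has_vector_derivative_diff)
      then show ?thesis by (simp add: add has_vector_derivative_at_within)
    qed
    then obtain c where "?\<phi> s = c" if "s \<in> {0..h}" for s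
      by (rule has_vector_derivative_zero_constant[OF convex_real_interval(5)]) (assumption, metis that)
    from this[of h] this[of 0] have "?\<phi> h = ?\<phi> 0" using h by simp
    then show ?thesis by (simp add: mm.diff_right algebra_simps)
  qed
  have G_eq: "G t = (F (t + h) - F t) ** (B /\<^sub>R h)" if "t \<in> {-1/2<..<1/2}" for t
  proof -
    have "\<bar>t\<bar> < 1/2" using that by auto
    then show ?thesis by (simp only: shift B matrix_mul_rid flip: matrix_mul_assoc)
  qed
  have "((\<lambda>t. (F (t + h) - F t) ** (B /\<^sub>R h)) has_vector_derivative (G h - G 0) ** (B /\<^sub>R h)) (at 0)"
  proof (intro bounded_linear.has_vector_derivative[OF mm.bounded_linear_left] has_vector_derivative_diff)
    show "((\<lambda>t. F (t + h)) has_vector_derivative G h) (at 0)"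
      using has_vector_derivative_shift[of F "G h" 0 h] F'[of h] h by simp
    show "(F has_vector_derivative G 0) (at 0)" using F'[of 0] by simp
  qed
  then have "(G has_vector_derivative (G h - G 0) ** (B /\<^sub>R h)) (at 0)"
    by (rule has_vector_derivative_transform_within_open[of _ _ _ "{-1/2<..<1/2}"]) (auto simp: G_eq)
  then show thesis by (rule that)
qed

section \<open>Gradients, Hessians and equality of mixed second derivatives\<close>

lemma gradient_has_derivative:
  fixes f :: "real ^ 'n \<Rightarrow> real"
  assumes "f differentiable at x"
  shows "(f has_derivative (\<lambda>h. gradient f x \<bullet> h)) (at x)"
proof -
  let ?f' = "frechet_derivative f (at x)"
  have D: "(f has_derivative ?f') (at x)" using assms by (simp add: frechet_derivative_works)
  then interpret linear ?f' by (rule has_derivative_linear)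
  have "?f' h = gradient f x \<bullet> h" for h
  proof -
    have "?f' h = ?f' (\<Sum>i\<in>UNIV. h $ i *\<^sub>R axis i 1)"
      by (simp add: basis_expansion flip: scalar_mult_eq_scaleR)
    also have "\<dots> = gradient f x \<bullet> h"
      by (simp add: sum scaleR gradient_def inner_vec_def mult.commute)
    finally show ?thesis .
  qed
  then have "?f' = (\<lambda>h. gradient f x \<bullet> h)" by auto
  with D show ?thesis by simp
qed

lemma gradient_eqI:
  fixes f :: "real ^ 'n \<Rightarrow> real"
  assumes "(f has_derivative (\<lambda>h. g \<bullet> h)) (at x)"
  shows "gradient f x = g"
proof -
  have "frechet_derivative f (at x) = (\<lambda>h. g \<bullet> h)"
    using frechet_derivative_at[OF assms] by (rule sym)
  then show ?thesis by (simp add: gradient_def vec_eq_iff inner_axis)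
qed

text \<open>The gradient is a finite combination of directional derivatives, each differentiable by
  the second level of \<open>ck_on\<close>.\<close>

lemma gradient_differentiable:
  fixes f :: "real ^ 'n \<Rightarrow> real"
  assumes "smooth_on UNIV f"
  shows "f differentiable at x" "gradient f differentiable at x"
proof -
  have ck: "ck_on (Suc (Suc 0)) UNIV f" using assms unfolding smooth_on_def by blast
  then show "f differentiable at x" by simp
  have "gradient f = (\<lambda>x. \<Sum>i\<in>UNIV. frechet_derivative f (at x) (axis i 1) *\<^sub>R axis i 1)"
    by (rule ext) (simp add: gradient_def basis_expansion[where x = "vec_lambda _", simplified] flip: scalar_mult_eq_scaleR)
  moreover have "(\<lambda>x. frechet_derivative f (at x) v) differentiable at x" for v
    using ck by simp
  ultimately show "gradient f differentiable at x" by (auto intro!: differentiable_sum differentiable_scaleR)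
qed

lemma hessian_has_derivative:
  assumes "smooth_on UNIV f"
  shows "(gradient f has_derivative (\<lambda>h. hessian f x *v h)) (at x)"
  unfolding hessian_def jacobian_works[symmetric] by (rule gradient_differentiable(2)[OF assms])

text \<open>The mean value theorem in direction u turns the second difference into a difference of
  two values of \<open>g\<close>. Both are compared with the linearization of \<open>g\<close> at x,
  whose linear parts differ by t times \<open>B v\<close>.\<close>

lemma second_difference_approx:
  fixes f :: "'a::euclidean_space \<Rightarrow> real" and g :: "'a \<Rightarrow> 'a"
  assumes f: "\<And>x. (f has_derivative (\<lambda>h. g x \<bullet> h)) (at x)" and g: "(g has_derivative B) (at x)"
    and "e > 0"
  shows "\<forall>\<^sub>F t in at_right 0. 
    \<bar>f (x + t *\<^sub>R u + t *\<^sub>R v) - f (x + t *\<^sub>R u) - f (x + t *\<^sub>R v) + f x - t\<^sup>2 * (B v \<bullet> u)\<bar> \<le> e * t\<^sup>2"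
proof -
  interpret B: linear B using g by (rule has_derivative_linear)
  define K where "K = norm u + norm v + 1"
  have K: "K > 0" by (simp add: K_def add_nonneg_pos)
  \<comment> \<open>Each linearization error is at most e' t K and there are two of them; pairing
    with u costs another factor K, which adds up to e t. The 1 in K keeps it positive.\<close>
  define e' where "e' = e / (2 * K\<^sup>2)"
  have "e' > 0" using \<open>e > 0\<close> K by (simp add: e'_def)
  then obtain \<delta> where "\<delta> > 0" and \<delta>: "\<And>w. norm w < \<delta> \<Longrightarrow> norm (g (x + w) - g x - B w) \<le> e' * norm w"
    using g unfolding has_derivative_at_alt by (metis add_diff_cancel_left')
  have *: "\<bar>f (x + t *\<^sub>R u + t *\<^sub>R v) - f (x + t *\<^sub>R u) - f (x + t *\<^sub>R v) + f x - t\<^sup>2 * (B v \<bullet> u)\<bar> \<le> e * t\<^sup>2"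
    if t: "0 < t" "t < \<delta> / K" for t
  proof -
    define \<phi> where "\<phi> s = f (x + s *\<^sub>R u + t *\<^sub>R v) - f (x + s *\<^sub>R u)" for s
    have der: "(\<phi> has_derivative (\<lambda>h. h * ((g (x + s *\<^sub>R u + t *\<^sub>R v) - g (x + s *\<^sub>R u)) \<bullet> u))) (at s)" for s
    proof -
      have "((\<lambda>s. f (x + s *\<^sub>R u + w)) has_derivative (\<lambda>h. g (x + s *\<^sub>R u + w) \<bullet> (h *\<^sub>R u))) (at s)" for w
        by (rule has_derivative_compose[OF _ f]) (auto intro!: derivative_eq_intros)
      from has_derivative_diff[OF this[of "t *\<^sub>R v"] this[of 0]] show ?thesis
        unfolding \<phi>_def by (simp add: inner_diff_left right_diff_distrib)
    qed
    have "\<exists>\<xi>\<in>{0<..<t}. \<phi> t - \<phi> 0 = (t - 0) * ((g (x + \<xi> *\<^sub>R u + t *\<^sub>R v) - g (x + \<xi> *\<^sub>R u)) \<bullet> u)"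
      using mvt_simple[of 0 t \<phi> "\<lambda>s h. h * ((g (x + s *\<^sub>R u + t *\<^sub>R v) - g (x + s *\<^sub>R u)) \<bullet> u)"] t der
      by (meson has_derivative_at_withinI)
    then obtain \<xi> where \<xi>: "0 < \<xi>" "\<xi> < t"
      "\<phi> t - \<phi> 0 = t * ((g (x + \<xi> *\<^sub>R u + t *\<^sub>R v) - g (x + \<xi> *\<^sub>R u)) \<bullet> u)" by auto
    have bound: "norm (g (x + w) - g x - B w) \<le> e' * (t * K)" if "norm w \<le> t * K" for w
    proof -
      have "norm w < \<delta>" using that t K by (simp add: pos_less_divide_eq)
      then have "norm (g (x + w) - g x - B w) \<le> e' * norm w" by (rule \<delta>)
      also have "\<dots> \<le> e' * (t * K)" using that \<open>e' > 0\<close> by simp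
      finally show ?thesis .
    qed
    have nu: "norm (\<xi> *\<^sub>R u) \<le> t * norm u" using \<xi> by (simp add: mult_right_mono)
    have w1: "norm (\<xi> *\<^sub>R u) \<le> t * K"
      using nu t by (rule_tac order_trans[OF nu]) (simp add: K_def)
    have w2: "norm (\<xi> *\<^sub>R u + t *\<^sub>R v) \<le> t * K"
      using nu norm_triangle_ineq[of "\<xi> *\<^sub>R u" "t *\<^sub>R v"] t by (simp add: K_def algebra_simps)
    let ?r = "(g (x + (\<xi> *\<^sub>R u + t *\<^sub>R v)) - g x - B (\<xi> *\<^sub>R u + t *\<^sub>R v)) - (g (x + \<xi> *\<^sub>R u) - g x - B (\<xi> *\<^sub>R u))"
    have "norm ?r \<le> e' * (t * K) + e' * (t * K)"
      by (rule order_trans[OF norm_triangle_ineq4 add_mono[OF bound[OF w2] bound[OF w1]]])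
    then have "\<bar>?r \<bullet> u\<bar> \<le> (e' * (t * K) + e' * (t * K)) * norm u"
      by (meson Cauchy_Schwarz_ineq2 mult_right_mono norm_ge_zero order_trans)
    also have "\<dots> \<le> (e' * (t * K) + e' * (t * K)) * K"
      using \<open>e' > 0\<close> t K by (intro mult_left_mono) (auto simp: K_def)
    also have "\<dots> = e * t" using K by (simp add: e'_def power2_eq_square)
    finally have r: "\<bar>?r \<bullet> u\<bar> \<le> e * t" .
    have "f (x + t *\<^sub>R u + t *\<^sub>R v) - f (x + t *\<^sub>R u) - f (x + t *\<^sub>R v) + f x - t\<^sup>2 * (B v \<bullet> u) 
      = t * (?r \<bullet> u)"
      using \<xi>(3) by (simp add: \<phi>_def B.add B.scaleR inner_diff_left add.assoc algebra_simps power2_eq_square)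
    then show ?thesis using mult_left_mono[OF r, of t] t by (simp add: abs_mult power2_eq_square mult_ac)
  qed
  show ?thesis
    by (rule eventually_mono[OF eventually_at_right_real[of 0 "\<delta> / K"]]) (use \<open>\<delta> > 0\<close> K * in auto)
qed

text \<open>The second difference is unchanged when u and v are swapped, so both inner products
  times t^2 approximate the same number up to a multiple of t^2 that can be made arbitrarily
  small.\<close>

lemma symmetric_second_derivative:
  fixes f :: "'a::euclidean_space \<Rightarrow> real" and g :: "'a \<Rightarrow> 'a"
  assumes f: "\<And>x. (f has_derivative (\<lambda>h. g x \<bullet> h)) (at x)" and g: "(g has_derivative B) (at x)"
  shows "B v \<bullet> u = B u \<bullet> v"
proof -
  have "\<bar>B v \<bullet> u - B u \<bullet> v\<bar> \<le> e" if "e > 0" for e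
  proof -
    have "\<forall>\<^sub>F t in at_right (0::real). \<bar>B v \<bullet> u - B u \<bullet> v\<bar> \<le> e"
      using second_difference_approx[OF f g half_gt_zero[OF that], of u v]
        second_difference_approx[OF f g half_gt_zero[OF that], of v u] eventually_at_right_less[of "0::real"]
    proof eventually_elim
      case (elim t)
      have comm: "x + t *\<^sub>R v + t *\<^sub>R u = x + t *\<^sub>R u + t *\<^sub>R v" by simp
      have "\<bar>t\<^sup>2 * (B v \<bullet> u) - t\<^sup>2 * (B u \<bullet> v)\<bar> \<le> e * t\<^sup>2"
        using elim(1,2) unfolding comm abs_le_iff by (intro conjI) linarith+
      then have "t\<^sup>2 * \<bar>B v \<bullet> u - B u \<bullet> v\<bar> \<le> t\<^sup>2 * e"
        unfolding right_diff_distrib[symmetric] abs_mult by (simp add: mult.commute)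
      then show ?case using elim(3) by simp
    qed
    then show ?thesis by simp
  qed
  then have "\<bar>B v \<bullet> u - B u \<bullet> v\<bar> \<le> 0 + e" if "e > 0" for e
    using that by simp
  then have "\<bar>B v \<bullet> u - B u \<bullet> v\<bar> \<le> 0" by (rule field_le_epsilon)
  then show ?thesis by simp
qed

lemma transpose_hessian:
  assumes "smooth_on UNIV f"
  shows "transpose (hessian f x) = hessian f x"
proof -
  have "(hessian f x *v v) \<bullet> u = (hessian f x *v u) \<bullet> v" for u v
    using symmetric_second_derivative[OF gradient_has_derivative hessian_has_derivative[OF assms]]
      gradient_differentiable(1)[OF assms] by blast
  from this[of "axis _ 1" "axis _ 1"] show ?thesis
    by (simp add: vec_eq_iff transpose_def inner_axis matrix_vector_mul_component inner_axis')
qed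

section \<open>Relative equilibria\<close>

lemma transpose_sympl: "transpose sympl = - sympl"
  by (auto simp: vec_eq_iff transpose_def sympl_def split: sum.split)

text \<open>The derivative at t = 0 of the invariance identity. With the skew symmetry of
  \<open>sympl\<close> it makes \<open>sympl ** S\<close> symmetric, so that this matrix is the
  Hessian of the momentum.\<close>

lemma infinitesimally_symplectic:
  fixes G :: "real \<Rightarrow> real ^ 'n ^ 'n"
  assumes "(G has_vector_derivative S) (at 0)" "G 0 = mat 1"
    and "\<And>t. transpose (G t) ** M ** G t = M"
  shows "transpose S ** M + M ** S = 0"
proof -
  have "((\<lambda>t. transpose (G t) ** (M ** G t)) has_vector_derivative
      transpose (G 0) ** (M ** S) + transpose S ** (M ** G 0)) (at 0)"
    by (intro bounded_bilinear.has_vector_derivative[OF bounded_bilinear_matrix_matrix_mult]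
        bounded_linear.has_vector_derivative[OF bounded_linear_transpose]
        bounded_linear.has_vector_derivative[OF bounded_bilinear.bounded_linear_right[OF bounded_bilinear_matrix_matrix_mult]] assms(1))
  moreover have "transpose (G t) ** (M ** G t) = M" for t
    using assms(3) by (simp add: matrix_mul_assoc)
  ultimately have "((\<lambda>t. M) has_vector_derivative M ** S + transpose S ** M) (at 0)"
    by (simp add: assms(2) transpose_mat)
  from vector_derivative_unique_at[OF this has_vector_derivative_const]
  show ?thesis by (simp add: add.commute)
qed

text \<open>Invariance of H makes \<open>transpose (G t) *v gradient H (G t *v Z)\<close> constant
  in t; the product rule at t = 0 gives the identity.\<close>

lemma hessian_of_invariant_function:
  assumes H: "smooth_on UNIV H" and G: "(G has_vector_derivative S) (at 0)" "G 0 = mat 1"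
    and inv: "\<And>t Z. H (G t *v Z) = H Z"
  shows "hessian H Z *v (S *v Z) = - (transpose S *v gradient H Z)"
proof -
  note grad = gradient_has_derivative[OF gradient_differentiable(1)[OF H]]
  have equiv: "transpose (G t) *v gradient H (G t *v Z) = gradient H Z" for t
  proof (rule gradient_eqI[symmetric])
    have "((\<lambda>Z. H (G t *v Z)) has_derivative (\<lambda>h. gradient H (G t *v Z) \<bullet> (G t *v h))) (at Z)"
      by (rule has_derivative_compose[OF bounded_linear_imp_has_derivative[OF matrix_vector_mul_bounded_linear] grad])
    then show "(H has_derivative (\<lambda>h. (transpose (G t) *v gradient H (G t *v Z)) \<bullet> h)) (at Z)"
      by (simp add: inv dot_lmul_matrix)
  qed
  have orbit: "((\<lambda>t. G t *v Z) has_vector_derivative S *v Z) (at 0)"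
    by (rule bounded_linear.has_vector_derivative[OF
          bounded_bilinear.bounded_linear_left[OF bounded_bilinear_matrix_vector_mult] G(1)])
  have "((\<lambda>t. gradient H (G t *v Z)) has_vector_derivative hessian H Z *v (S *v Z)) (at 0)"
    using has_derivative_compose[OF orbit[unfolded has_vector_derivative_def] hessian_has_derivative[OF H]]
    by (simp add: has_vector_derivative_def G(2) matrix_vector_mult_scaleR)
  then have "((\<lambda>t. transpose (G t) *v gradient H (G t *v Z)) has_vector_derivative
      transpose (G 0) *v (hessian H Z *v (S *v Z)) + transpose S *v gradient H (G 0 *v Z)) (at 0)"
    by (intro bounded_bilinear.has_vector_derivative[OF bounded_bilinear_matrix_vector_mult]
        bounded_linear.has_vector_derivative[OF bounded_linear_transpose] G(1))
  then have "((\<lambda>t. gradient H Z) has_vector_derivative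
      hessian H Z *v (S *v Z) + transpose S *v gradient H Z) (at 0)"
    unfolding equiv by (simp add: G(2) transpose_mat del: transpose_matrix_vector)
  from vector_derivative_unique_at[OF this has_vector_derivative_const]
  show ?thesis by (simp add: eq_neg_iff_add_eq_0)
qed

lemma quadratic_form_has_derivative:
  fixes A :: "real ^ 'n ^ 'n"
  assumes "transpose A = A"
  shows "((\<lambda>Z. 1/2 * ((A *v Z) \<bullet> Z)) has_derivative (\<lambda>h. (A *v Z) \<bullet> h)) (at Z)"
proof -
  have "(A *v h) \<bullet> Z = (A *v Z) \<bullet> h" for h
    using assms by (metis dot_lmul_matrix inner_commute transpose_matrix_vector)
  moreover have "((\<lambda>Z. 1/2 * ((A *v Z) \<bullet> Z)) has_derivative
      (\<lambda>h. 1/2 * ((A *v Z) \<bullet> h + (A *v h) \<bullet> Z))) (at Z)"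
    by (intro has_derivative_mult_right has_derivative_inner has_derivative_ident
        bounded_linear_imp_has_derivative matrix_vector_mul_bounded_linear)
  ultimately show ?thesis by simp
qed

lemma jacobian_matrix_vector_mult:
  fixes A :: "real ^ 'n ^ 'm"
  shows "jacobian ((*v) A) (at x) = A"
proof -
  have "((*v) A has_derivative (*v) A) (at x)"
    by (intro bounded_linear_imp_has_derivative matrix_vector_mul_bounded_linear)
  from frechet_derivative_at[OF this] show ?thesis
    by (simp add: jacobian_def flip: frechet_derivative_at)
qed

text \<open>An equation between functions, so that it also rewrites the inner \<open>deriv\<close>
  of an iterated derivative.\<close>

lemma deriv_poly: "deriv (poly p) = poly (pderiv p)"
  for p :: "real poly"
  by (rule ext) (rule DERIV_imp_deriv[OF poly_DERIV])

theorem theorem2p2: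
  fixes H :: "real ^ ('n::finite + 'n) \<Rightarrow> real"
    and G :: "real \<Rightarrow> real ^ ('n + 'n) ^ ('n + 'n)"
    and U :: "real \<Rightarrow> real ^ ('n + 'n)"
    and C :: "real set"
  assumes "smooth_on UNIV H"
    and "orthogonal_circle_action G"
    and "\<And>\<theta>. transpose (G \<theta>) ** sympl ** G \<theta> = sympl"
    and "\<And>\<theta> Z. H (G \<theta> *v Z) = H Z"
    and "open C"
    and "smooth_on C U"
    and "\<And>c. c \<in> C \<Longrightarrow> gradient H (U c) = c *\<^sub>R gradient (momentum G) (U c)"
    and "\<And>c. c \<in> C \<Longrightarrow> deriv (\<lambda>s. momentum G (U s)) c \<noteq> 0"
    and "\<And>c. c \<in> C \<Longrightarrow> simple_eigenvalue (lin_op H G U c) 0"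
  shows "\<forall>c\<in>C. char_fun H G U c 0 = 0 \<and>
           deriv (char_fun H G U c) 0 = 0 \<and>
           deriv (deriv (char_fun H G U c)) 0
             = nonzero_eigenvalue_prod (lin_op H G U c) * deriv (\<lambda>s. momentum G (U s)) c"
proof
  fix c assume c: "c \<in> C"
  have G: "continuous_on UNIV G" "G 0 = mat 1" "\<And>s t. G (s + t) = G s ** G t"
    using assms(2) by (auto simp: orthogonal_circle_action_def)
  obtain S where S: "(G has_vector_derivative S) (at 0)"
    by (rule continuous_matrix_group_differentiable[OF G])
  have "((\<lambda>t. G t *v Z) has_vector_derivative S *v Z) (at 0)" for Z
    by (rule bounded_linear.has_vector_derivative[OF
          bounded_bilinear.bounded_linear_left[OF bounded_bilinear_matrix_vector_mult] S])
  then have infgen: "infgen G = (*v) S"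
    by (auto simp: infgen_def vector_derivative_at)
  let ?M = "sympl :: real ^ ('n + 'n) ^ ('n + 'n)"
  define A where "A = ?M ** S"
  have TS: "transpose S ** ?M = - A"
    using infinitesimally_symplectic[OF S G(2) assms(3)] by (simp add: A_def eq_neg_iff_add_eq_0)
  have "transpose A = - (transpose S ** ?M)"
    by (simp add: A_def matrix_transpose_mul transpose_sympl bounded_bilinear.minus_right[OF bounded_bilinear_matrix_matrix_mult])
  then have symA: "transpose A = A" by (simp add: TS)
  have mom: "momentum G = (\<lambda>Z. 1/2 * ((A *v Z) \<bullet> Z))"
    by (simp add: fun_eq_iff momentum_def infgen_matrix_def infgen A_def)
  have mom': "(momentum G has_derivative (\<lambda>h. (A *v Z) \<bullet> h)) (at Z)" for Z
    unfolding mom by (rule quadratic_form_has_derivative[OF symA])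
  then have gradmom: "gradient (momentum G) = (*v) A"
    by (intro ext gradient_eqI)
  have L: "lin_op H G U c = hessian H (U c) - c *\<^sub>R A"
    by (simp add: lin_op_def hessian_def[of "momentum G"] gradmom jacobian_matrix_vector_mult)
  have LL: "transpose (lin_op H G U c) = lin_op H G U c"
    unfolding L using transpose_hessian[OF assms(1), of "U c"] symA
    by (simp add: transpose_def vec_eq_iff)
  define v where "v = S *v U c"
  have AU: "A *v U c = ?M *v v" by (simp add: A_def v_def matrix_vector_mul_assoc)
  \<comment> \<open>The equilibrium equation reads grad H = c M v at \<open>U c\<close>, and
    \<open>transpose S ** ?M = - A\<close> turns the right-hand side into c A v, the part subtracted
    in L.\<close>
  have "hessian H (U c) *v v = - (transpose S *v (c *\<^sub>R (?M *v v)))"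
    unfolding v_def hessian_of_invariant_function[OF assms(1) S G(2) assms(4)] assms(7)[OF c]
    by (simp only: gradmom AU v_def)
  also have "\<dots> = c *\<^sub>R - ((transpose S ** ?M) *v v)"
    by (simp add: matrix_vector_mult_scaleR matrix_vector_mul_assoc del: transpose_matrix_vector)
  also have "\<dots> = c *\<^sub>R (A *v v)"
    unfolding TS by (simp add: bounded_bilinear.minus_left[OF bounded_bilinear_matrix_vector_mult])
  finally have Lv: "lin_op H G U c *v v = 0"
    by (simp add: L matrix_vector_mult_diff_rdistrib scaleR_matrix_vector_assoc)
  have "ck_on (Suc 0) C U" using assms(6) unfolding smooth_on_def by blast
  then have "U differentiable (at c)" using c by simp
  then obtain b where b: "(U has_vector_derivative b) (at c)"
    by (auto simp: vector_derivative_works)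
  have "((\<lambda>s. gradient H (U s)) has_vector_derivative hessian H (U c) *v b) (at c)"
    using has_derivative_compose[OF b[unfolded has_vector_derivative_def] hessian_has_derivative[OF assms(1)]]
    by (simp add: has_vector_derivative_def matrix_vector_mult_scaleR)
  \<comment> \<open>The equilibrium equation holds only for parameters in C; openness of C allows it
    to be differentiated at c. The product rule contributes the extra term \<open>A *v U c\<close>,
    which is M v.\<close>
  moreover have "((\<lambda>s. gradient H (U s)) has_vector_derivative c *\<^sub>R (A *v b) + A *v U c) (at c)"
  proof (rule has_vector_derivative_transform_within_open[OF _ assms(5) c])
    have "((\<lambda>s. A *v U s) has_vector_derivative A *v b) (at c)"
      by (rule bounded_linear.has_vector_derivative[OF matrix_vector_mul_bounded_linear b])
    from has_vector_derivative_scaleR[OF DERIV_ident this]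
    show "((\<lambda>s. s *\<^sub>R (A *v U s)) has_vector_derivative c *\<^sub>R (A *v b) + A *v U c) (at c)" by simp
    show "s *\<^sub>R (A *v U s) = gradient H (U s)" if "s \<in> C" for s
      using assms(7)[OF that] by (simp add: gradmom)
  qed
  ultimately have "hessian H (U c) *v b = c *\<^sub>R (A *v b) + A *v U c"
    by (rule vector_derivative_unique_at)
  then have Lb: "lin_op H G U c *v b = ?M *v v"
    by (simp add: L matrix_vector_mult_diff_rdistrib AU flip: scaleR_matrix_vector_assoc)
  have "((\<lambda>s. momentum G (U s)) has_derivative (\<lambda>h. (A *v U c) \<bullet> (h *\<^sub>R b))) (at c)"
    by (rule has_derivative_compose[OF b[unfolded has_vector_derivative_def] mom'])
  then have "((\<lambda>s. momentum G (U s)) has_field_derivative (?M *v v) \<bullet> b) (at c)"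
    by (rule has_derivative_imp_has_field_derivative) (simp add: AU mult.commute)
  then have dI: "deriv (\<lambda>s. momentum G (U s)) c = (?M *v v) \<bullet> b"
    by (rule DERIV_imp_deriv)
  \<comment> \<open>Skew symmetry of M supplies the sign that cancels the minus in the coefficient
    formula of the pencil.\<close>
  have vMb: "v \<bullet> (?M *v b) = - ((?M *v v) \<bullet> b)"
  proof -
    have "v \<bullet> (?M *v b) = (transpose ?M *v v) \<bullet> b" by (simp add: dot_lmul_matrix)
    then show ?thesis
      by (simp add: transpose_sympl bounded_bilinear.minus_left[OF bounded_bilinear_matrix_vector_mult] del: transpose_matrix_vector)
  qed
  have "v \<noteq> 0" using assms(8)[OF c] dI by auto
  obtain p where p: "\<And>z. poly p z = det (lin_op H G U c - z *\<^sub>R ?M)" "coeff p 0 = 0"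
    "(v \<bullet> v) * coeff p (Suc 0) = 0"
    "(v \<bullet> v)\<^sup>2 * coeff p 2 = - (v \<bullet> v) * (v \<bullet> (?M *v b)) * nonzero_eigenvalue_prod (lin_op H G U c)"
    using second_order_det_pencil[OF LL assms(9)[OF c] Lv Lb] by blast
  have p1: "coeff p (Suc 0) = 0" using p(3) \<open>v \<noteq> 0\<close> by simp
  have p2: "(v \<bullet> v) * coeff p 2 = nonzero_eigenvalue_prod (lin_op H G U c) * deriv (\<lambda>s. momentum G (U s)) c"
    using p(4) \<open>v \<noteq> 0\<close> by (simp add: vMb dI power2_eq_square mult.assoc)
  have "char_fun H G U c = poly (smult (1/2 * (v \<bullet> v)) p)"
    by (simp add: fun_eq_iff char_fun_def infgen p(1) v_def dot_square_norm)
  then show "char_fun H G U c 0 = 0 \<and> deriv (char_fun H G U c) 0 = 0 \<and>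
      deriv (deriv (char_fun H G U c)) 0
        = nonzero_eigenvalue_prod (lin_op H G U c) * deriv (\<lambda>s. momentum G (U s)) c"
    using p(2) p1 p2 by (simp add: deriv_poly poly_0_coeff_0 coeff_pderiv pderiv_smult numeral_2_eq_2)
qed

end
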